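(* Let $\mathsf{K}$ be an essentially small triangulated category such that the lattice $T(\mathsf{K})$ of thick subcategories of $\mathsf{K}$ is distributive. Then the comparison map $$T(\mathsf{K})\to\mathcal{O}\,\mathrm{Spcnt}\,\mathsf{K},\qquad \mathsf{M}\mapsto U_{\mathsf{M}}=\{\mathsf{P}\in\mathrm{Spcnt}\,\mathsf{K}\mid \mathsf{M}\nsubseteq\mathsf{P}\},$$ is a lattice isomorphism, i.e. thick subcategories of $\mathsf{K}$ are classified by $\mathrm{Spcnt}\,\mathsf{K}$. The inverse is given by sending an open subset $U$ to the thick subcategory $$\bigcap_{\mathsf{P}\notin U}\mathsf{P},$$ where $\mathrm{Spcnt}\,\mathsf{K}$ is identified with the space of meet-prime thick subcategories.
   Context: A thick subcategory of a triangulated category is a full subcategory closed under isomorphisms, suspensions, cones and direct summands. $T(\mathsf{K})=\mathrm{Thick}(\mathsf{K})$ is the complete lattice of thick subcategories of $\mathsf{K}$ ordered by inclusion; meets are intersections, and the join of a family is the smallest thick subcategory containing its union. A thick subcategory $\mathsf{P}\neq\mathsf{K}$ is meet-prime if $\mathsf{A}\cap\mathsf{B}\subseteq\mathsf{P}$ implies $\mathsf{A}\subseteq\mathsf{P}$ or $\mathsf{B}\subseteq\mathsf{P}$ for all thick subcategories $\mathsf{A},\mathsf{B}$. The non-tensor spectrum $\mathrm{Spcnt}\,\mathsf{K}$ is the space of poset maps $p\colon T(\mathsf{K})\to\mathbf{2}=\{0\le 1\}$ preserving finite meets and arbitrary joins, with opens $\{p\mid p(\mathsf{M})=1\}$, $\mathsf{M}\in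 T(\mathsf{K})$. It is identified with the set of meet-prime thick subcategories via $p(\mathsf{M})=0\iff\mathsf{M}\subseteq\mathsf{P}$; under this identification the open subsets are the $U_{\mathsf{M}}$. $\mathcal{O}X$ denotes the lattice of open subsets of $X$. An intersection indexed by the empty set is $\mathsf{K}$. *)

theory Defs
  imports "HOL-Algebra.Group" "HOL-Analysis.Abstract_Topology"
begin

section \<open>Triangulated categories\<close>

text \<open>
  The objects and the arrows of a category form sets of HOL types, so the categories below are
  small. An essentially small category is equivalent to a small one, and such an equivalence
  preserves the lattice of thick subcategories, as these are closed under isomorphism.
\<close>

record ('o, 'm) cat_struct =
  Obj :: "'o set"
  Arr :: "'m set"
  Dom :: "'m \<Rightarrow> 'o"
  Cod :: "'m \<Rightarrow> 'o"
  Ident :: "'o \<Rightarrow> 'm"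
  Comp :: "'m \<Rightarrow> 'm \<Rightarrow> 'm"  (infixl \<open>\<cdot>\<index>\<close> 70)

definition Hom :: "('o, 'm, 'x) cat_struct_scheme \<Rightarrow> 'o \<Rightarrow> 'o \<Rightarrow> 'm set" where
  "Hom K x y = {f \<in> Arr K. Dom K f = x \<and> Cod K f = y}"

locale category =
  fixes K :: "('o, 'm, 'x) cat_struct_scheme" (structure)
  assumes Dom_closed: "f \<in> Arr K \<Longrightarrow> Dom K f \<in> Obj K"
    and Cod_closed: "f \<in> Arr K \<Longrightarrow> Cod K f \<in> Obj K"
    and Ident_closed: "x \<in> Obj K \<Longrightarrow> Ident K x \<in> Hom K x x"
    and Comp_closed: "\<lbrakk>f \<in> Hom K x y; g \<in> Hom K y z\<rbrakk> \<Longrightarrow> g \<cdot> f \<in> Hom K x z"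
    and Comp_Ident_left: "f \<in> Hom K x y \<Longrightarrow> Ident K y \<cdot> f = f"
    and Comp_Ident_right: "f \<in> Hom K x y \<Longrightarrow> f \<cdot> Ident K x = f"
    and Comp_assoc:
      "\<lbrakk>f \<in> Hom K w x; g \<in> Hom K x y; h \<in> Hom K y z\<rbrakk> \<Longrightarrow> (h \<cdot> g) \<cdot> f = h \<cdot> (g \<cdot> f)"

definition iso_arrow :: "('o, 'm, 'x) cat_struct_scheme \<Rightarrow> 'o \<Rightarrow> 'o \<Rightarrow> 'm \<Rightarrow> bool" where
  "iso_arrow K x y f \<longleftrightarrow> f \<in> Hom K x y \<and>
    (\<exists>g \<in> Hom K y x. g \<cdot>\<^bsub>K\<^esub> f = Ident K x \<and> f \<cdot>\<^bsub>K\<^esub> g = Ident K y)"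

definition isomorphic :: "('o, 'm, 'x) cat_struct_scheme \<Rightarrow> 'o \<Rightarrow> 'o \<Rightarrow> bool" where
  "isomorphic K x y \<longleftrightarrow> (\<exists>f. iso_arrow K x y f)"

definition zero_object :: "('o, 'm, 'x) cat_struct_scheme \<Rightarrow> 'o \<Rightarrow> bool" where
  "zero_object K z \<longleftrightarrow> z \<in> Obj K \<and>
    (\<forall>x \<in> Obj K. (\<exists>!f. f \<in> Hom K x z) \<and> (\<exists>!f. f \<in> Hom K z x))"

record ('o, 'm) add_cat_struct = "('o, 'm) cat_struct" +
  Add :: "'m \<Rightarrow> 'm \<Rightarrow> 'm"
  Zero :: "'o \<Rightarrow> 'o \<Rightarrow> 'm"

definition hom_group :: "('o, 'm, 'x) add_cat_struct_scheme \<Rightarrow> 'o \<Rightarrow> 'o \<Rightarrow> 'm monoid" where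
  "hom_group K x y = \<lparr>carrier = Hom K x y, monoid.mult = Add K, one = Zero K x y\<rparr>"

definition biproduct ::
  "('o, 'm, 'x) add_cat_struct_scheme \<Rightarrow> 'o \<Rightarrow> 'o \<Rightarrow> 'o \<Rightarrow> 'm \<Rightarrow> 'm \<Rightarrow> 'm \<Rightarrow> 'm \<Rightarrow> bool" where
  "biproduct K x y s i j p q \<longleftrightarrow>
    i \<in> Hom K x s \<and> j \<in> Hom K y s \<and> p \<in> Hom K s x \<and> q \<in> Hom K s y \<and>
    p \<cdot>\<^bsub>K\<^esub> i = Ident K x \<and> q \<cdot>\<^bsub>K\<^esub> j = Ident K y \<and>
    q \<cdot>\<^bsub>K\<^esub> i = Zero K x y \<and> p \<cdot>\<^bsub>K\<^esub> j = Zero K y x \<and>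
    Add K (i \<cdot>\<^bsub>K\<^esub> p) (j \<cdot>\<^bsub>K\<^esub> q) = Ident K s"

definition direct_summand :: "('o, 'm, 'x) add_cat_struct_scheme \<Rightarrow> 'o \<Rightarrow> 'o \<Rightarrow> bool" where
  "direct_summand K x s \<longleftrightarrow> x \<in> Obj K \<and> s \<in> Obj K \<and>
    (\<exists>y \<in> Obj K. \<exists>i j p q. biproduct K x y s i j p q)"

locale additive_category = category K
  for K :: "('o, 'm, 'x) add_cat_struct_scheme" (structure) +
  assumes hom_comm_group: "\<lbrakk>x \<in> Obj K; y \<in> Obj K\<rbrakk> \<Longrightarrow> comm_group (hom_group K x y)"
    and Comp_Add_right: "\<lbrakk>f \<in> Hom K x y; f' \<in> Hom K x y; g \<in> Hom K y z\<rbrakk>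
      \<Longrightarrow> g \<cdot> Add K f f' = Add K (g \<cdot> f) (g \<cdot> f')"
    and Comp_Add_left: "\<lbrakk>f \<in> Hom K x y; g \<in> Hom K y z; g' \<in> Hom K y z\<rbrakk>
      \<Longrightarrow> Add K g g' \<cdot> f = Add K (g \<cdot> f) (g' \<cdot> f)"
    and zero_object_exists: "\<exists>z. zero_object K z"
    and biproduct_exists: "\<lbrakk>x \<in> Obj K; y \<in> Obj K\<rbrakk>
      \<Longrightarrow> \<exists>s \<in> Obj K. \<exists>i j p q. biproduct K x y s i j p q"

text \<open>
  The fields \<open>Susp\<close> and \<open>SuspArr\<close> are the suspension functor on objects and on arrows;
  an element \<open>(f, g, h)\<close> of \<open>Dist\<close> is a distinguished triangle
  \<open>x \<rightarrow> y \<rightarrow> z \<rightarrow> Susp x\<close>.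
\<close>

record ('o, 'm) tri_cat_struct = "('o, 'm) add_cat_struct" +
  Susp :: "'o \<Rightarrow> 'o"
  SuspArr :: "'m \<Rightarrow> 'm"
  Dist :: "('m \<times> 'm \<times> 'm) set"

definition triangle ::
  "('o, 'm, 'x) tri_cat_struct_scheme \<Rightarrow> 'o \<Rightarrow> 'o \<Rightarrow> 'o \<Rightarrow> 'm \<Rightarrow> 'm \<Rightarrow> 'm \<Rightarrow> bool" where
  "triangle K x y z f g h \<longleftrightarrow>
    f \<in> Hom K x y \<and> g \<in> Hom K y z \<and> h \<in> Hom K z (Susp K x)"

definition dist_triangle ::
  "('o, 'm, 'x) tri_cat_struct_scheme \<Rightarrow> 'o \<Rightarrow> 'o \<Rightarrow> 'o \<Rightarrow> 'm \<Rightarrow> 'm \<Rightarrow> 'm \<Rightarrow> bool" where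
  "dist_triangle K x y z f g h \<longleftrightarrow> triangle K x y z f g h \<and> (f, g, h) \<in> Dist K"

text \<open>Verdier's axioms; the suspension is an additive autoequivalence.\<close>

locale triangulated_category = additive_category K
  for K :: "('o, 'm, 'x) tri_cat_struct_scheme" (structure) +
  assumes Susp_closed: "x \<in> Obj K \<Longrightarrow> Susp K x \<in> Obj K"
    and SuspArr_Ident: "x \<in> Obj K \<Longrightarrow> SuspArr K (Ident K x) = Ident K (Susp K x)"
    and SuspArr_Comp: "\<lbrakk>f \<in> Hom K x y; g \<in> Hom K y z\<rbrakk>
      \<Longrightarrow> SuspArr K (g \<cdot> f) = SuspArr K g \<cdot> SuspArr K f"
    and SuspArr_Add: "\<lbrakk>f \<in> Hom K x y; f' \<in> Hom K x y\<rbrakk>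
      \<Longrightarrow> SuspArr K (Add K f f') = Add K (SuspArr K f) (SuspArr K f')"
    and SuspArr_bij: "\<lbrakk>x \<in> Obj K; y \<in> Obj K\<rbrakk>
      \<Longrightarrow> bij_betw (SuspArr K) (Hom K x y) (Hom K (Susp K x) (Susp K y))"
    and Susp_essentially_surjective: "y \<in> Obj K \<Longrightarrow> \<exists>x \<in> Obj K. isomorphic K (Susp K x) y"
    and Dist_triangle: "(f, g, h) \<in> Dist K \<Longrightarrow> \<exists>x y z. triangle K x y z f g h"
    and TR1_iso: "\<lbrakk>dist_triangle K x y z f g h; triangle K x' y' z' f' g' h';
        iso_arrow K x x' a; iso_arrow K y y' b; iso_arrow K z z' c;
        f' \<cdot> a = b \<cdot> f; g' \<cdot> b = c \<cdot> g; h' \<cdot> c = SuspArr K a \<cdot> h\<rbrakk>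
      \<Longrightarrow> dist_triangle K x' y' z' f' g' h'"
    and TR1_Ident: "\<lbrakk>x \<in> Obj K; zero_object K z\<rbrakk>
      \<Longrightarrow> dist_triangle K x x z (Ident K x) (Zero K x z) (Zero K z (Susp K x))"
    and TR1_cone: "f \<in> Hom K x y \<Longrightarrow> \<exists>z g h. dist_triangle K x y z f g h"
    and TR2: "triangle K x y z f g h \<Longrightarrow>
      dist_triangle K x y z f g h \<longleftrightarrow>
      dist_triangle K y z (Susp K x) g h (inv\<^bsub>hom_group K (Susp K x) (Susp K y)\<^esub> SuspArr K f)"
    and TR3: "\<lbrakk>dist_triangle K x y z f g h; dist_triangle K x' y' z' f' g' h';
        a \<in> Hom K x x'; b \<in> Hom K y y'; f' \<cdot> a = b \<cdot> f\<rbrakk>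
      \<Longrightarrow> \<exists>c \<in> Hom K z z'. g' \<cdot> b = c \<cdot> g \<and> h' \<cdot> c = SuspArr K a \<cdot> h"
    and TR4: "\<lbrakk>dist_triangle K x y u f f' f''; dist_triangle K y z v g g' g'';
        dist_triangle K x z w (g \<cdot> f) h' h''\<rbrakk>
      \<Longrightarrow> \<exists>a b. dist_triangle K u w v a b (SuspArr K f' \<cdot> g'') \<and>
            a \<cdot> f' = h' \<cdot> g \<and> h'' \<cdot> a = f'' \<and> b \<cdot> h' = g' \<and> g'' \<cdot> b = SuspArr K f \<cdot> h''"


section \<open>The lattice of thick subcategories\<close>

text \<open>
  A full subcategory is given by its set of objects. Subcategories are nonempty, and closure under
  suspensions refers to all powers of the suspension, negative ones included.
\<close>

definition thick :: "('o, 'm, 'x) tri_cat_struct_scheme \<Rightarrow> 'o set \<Rightarrow> bool" where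
  "thick K A \<longleftrightarrow> A \<subseteq> Obj K \<and> A \<noteq> {} \<and>
    (\<forall>x y. x \<in> A \<and> isomorphic K x y \<longrightarrow> y \<in> A) \<and>
    (\<forall>x \<in> Obj K. x \<in> A \<longleftrightarrow> Susp K x \<in> A) \<and>
    (\<forall>x y z f g h. dist_triangle K x y z f g h \<and> x \<in> A \<and> y \<in> A \<longrightarrow> z \<in> A) \<and>
    (\<forall>x s. direct_summand K x s \<and> s \<in> A \<longrightarrow> x \<in> A)"

definition thick_lattice :: "('o, 'm, 'x) tri_cat_struct_scheme \<Rightarrow> 'o set gorder" where
  "thick_lattice K = \<lparr>carrier = {A. thick K A}, eq = (=), le = (\<subseteq>)\<rparr>"

definition distributive :: "('a, 'b) gorder_scheme \<Rightarrow> bool" where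
  "distributive L \<longleftrightarrow> (\<forall>a \<in> carrier L. \<forall>b \<in> carrier L. \<forall>c \<in> carrier L.
    a \<sqinter>\<^bsub>L\<^esub> (b \<squnion>\<^bsub>L\<^esub> c) = (a \<sqinter>\<^bsub>L\<^esub> b) \<squnion>\<^bsub>L\<^esub> (a \<sqinter>\<^bsub>L\<^esub> c))"

definition lattice_iso :: "('a, 'x) gorder_scheme \<Rightarrow> ('b, 'y) gorder_scheme \<Rightarrow> ('a \<Rightarrow> 'b) \<Rightarrow> bool" where
  "lattice_iso L M f \<longleftrightarrow> bij_betw f (carrier L) (carrier M) \<and>
    (\<forall>a \<in> carrier L. \<forall>b \<in> carrier L.
      f (a \<sqinter>\<^bsub>L\<^esub> b) = f a \<sqinter>\<^bsub>M\<^esub> f b \<and> f (a \<squnion>\<^bsub>L\<^esub> b) = f a \<squnion>\<^bsub>M\<^esub> f b)"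

definition open_lattice :: "'a topology \<Rightarrow> 'a set gorder" where
  "open_lattice X = \<lparr>carrier = {U. openin X U}, eq = (=), le = (\<subseteq>)\<rparr>"

lemma thick_lattice_simps [simp]:
  "carrier (thick_lattice K) = {A. thick K A}"
  "(.=\<^bsub>thick_lattice K\<^esub>) = (=)"
  "(\<sqsubseteq>\<^bsub>thick_lattice K\<^esub>) = (\<subseteq>)"
  by (simp_all add: thick_lattice_def)

lemma open_lattice_simps [simp]:
  "carrier (open_lattice X) = {U. openin X U}"
  "(.=\<^bsub>open_lattice X\<^esub>) = (=)"
  "(\<sqsubseteq>\<^bsub>open_lattice X\<^esub>) = (\<subseteq>)"
  by (simp_all add: open_lattice_def)

lemma Hom_objects:
  assumes "category K" "f \<in> Hom K x y"
  shows "x \<in> Obj K" "y \<in> Obj K"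
  using assms category.Dom_closed category.Cod_closed by (fastforce simp: Hom_def)+

lemma thickD:
  assumes "thick K A"
  shows thick_subset: "A \<subseteq> Obj K"
    and thick_nonempty: "A \<noteq> {}"
    and thick_iso: "\<lbrakk>x \<in> A; isomorphic K x y\<rbrakk> \<Longrightarrow> y \<in> A"
    and thick_Susp: "x \<in> Obj K \<Longrightarrow> x \<in> A \<longleftrightarrow> Susp K x \<in> A"
    and thick_cone: "\<lbrakk>dist_triangle K x y z f g h; x \<in> A; y \<in> A\<rbrakk> \<Longrightarrow> z \<in> A"
    and thick_summand: "\<lbrakk>direct_summand K x s; s \<in> A\<rbrakk> \<Longrightarrow> x \<in> A"
proof -
  have *: "A \<subseteq> Obj K" "A \<noteq> {}"
    "\<forall>x y. x \<in> A \<and> isomorphic K x y \<longrightarrow> y \<in> A"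
    "\<forall>x \<in> Obj K. x \<in> A \<longleftrightarrow> Susp K x \<in> A"
    "\<forall>x y z f g h. dist_triangle K x y z f g h \<and> x \<in> A \<and> y \<in> A \<longrightarrow> z \<in> A"
    "\<forall>x s. direct_summand K x s \<and> s \<in> A \<longrightarrow> x \<in> A"
    using assms unfolding thick_def by - (elim conjE, assumption)+
  show "A \<subseteq> Obj K" "A \<noteq> {}" by (fact *)+
  show "\<lbrakk>x \<in> A; isomorphic K x y\<rbrakk> \<Longrightarrow> y \<in> A" using *(3) by blast
  show "x \<in> Obj K \<Longrightarrow> x \<in> A \<longleftrightarrow> Susp K x \<in> A" using *(4) by blast
  show "\<lbrakk>dist_triangle K x y z f g h; x \<in> A; y \<in> A\<rbrakk> \<Longrightarrow> z \<in> A" using *(5) by blast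
  show "\<lbrakk>direct_summand K x s; s \<in> A\<rbrakk> \<Longrightarrow> x \<in> A" using *(6) by blast
qed

lemma thick_Obj:
  assumes "triangulated_category K"
  shows "thick K (Obj K)"
proof -
  interpret triangulated_category K by fact
  show ?thesis
    unfolding thick_def
  proof (intro conjI allI impI ballI)
    show "Obj K \<noteq> {}"
      using zero_object_exists by (auto simp: zero_object_def)
    show "y \<in> Obj K" if "x \<in> Obj K \<and> isomorphic K x y" for x y
      using that Hom_objects[OF category_axioms] by (auto simp: isomorphic_def iso_arrow_def)
    show "x \<in> Obj K \<longleftrightarrow> Susp K x \<in> Obj K" if "x \<in> Obj K" for x
      using that Susp_closed by simp
    show "z \<in> Obj K" if "dist_triangle K x y z f g h \<and> x \<in> Obj K \<and> y \<in> Obj K" for x y z f g h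
      using that Hom_objects[OF category_axioms] by (auto simp: dist_triangle_def triangle_def)
    show "x \<in> Obj K" if "direct_summand K x s \<and> s \<in> Obj K" for x s
      using that by (simp add: direct_summand_def)
  qed simp
qed

lemma thick_zero_object:
  assumes "triangulated_category K" "thick K A" "zero_object K z"
  shows "z \<in> A"
proof -
  interpret triangulated_category K by fact
  obtain x where "x \<in> A" "x \<in> Obj K"
    using thick_subset[OF assms(2)] thick_nonempty[OF assms(2)] by blast
  with thick_cone[OF assms(2) TR1_Ident[OF this(2) assms(3)]] show ?thesis by blast
qed

lemma thick_Inter:
  assumes K: "triangulated_category K" and S: "\<And>A. A \<in> S \<Longrightarrow> thick K A"
  shows "thick K (Obj K \<inter> \<Inter>S)"
proof -
  interpret triangulated_category K by fact
  obtain z where "zero_object K z" using zero_object_exists by blast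
  then have "z \<in> B" if "thick K B" for B
    using thick_zero_object[OF K that] by blast
  then have ne: "z \<in> Obj K \<inter> \<Inter>S"
    using S thick_Obj[OF K] by blast
  let ?T = "insert (Obj K) S"
  have T: "thick K A" if "A \<in> ?T" for A
    using that S thick_Obj[OF K] by blast
  have "thick K (\<Inter>?T)"
    unfolding thick_def
  proof (intro conjI allI impI ballI)
    show "\<Inter>?T \<subseteq> Obj K" "\<Inter>?T \<noteq> {}" using ne by auto
    show "y \<in> \<Inter>?T" if "x \<in> \<Inter>?T \<and> isomorphic K x y" for x y
    proof (rule InterI)
      fix A assume A: "A \<in> ?T"
      with that have "x \<in> A" by blast
      with thick_iso[OF T[OF A]] that show "y \<in> A" by blast
    qed
    show "(x \<in> \<Inter>?T) = (Susp K x \<in> \<Inter>?T)" if "x \<in> Obj K" for x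
    proof -
      have "(x \<in> A) = (Susp K x \<in> A)" if "A \<in> ?T" for A
        using thick_Susp[OF T[OF that] \<open>x \<in> Obj K\<close>] .
      then show ?thesis unfolding Inter_iff by blast
    qed
    show "z \<in> \<Inter>?T" if "dist_triangle K x y z f g h \<and> x \<in> \<Inter>?T \<and> y \<in> \<Inter>?T"
      for x y z f g h
    proof (rule InterI)
      fix A assume A: "A \<in> ?T"
      from that have "x \<in> \<Inter>?T" "y \<in> \<Inter>?T" by simp_all
      with A have "x \<in> A" "y \<in> A" by blast+
      with thick_cone[OF T[OF A]] that show "z \<in> A" by metis
    qed
    show "x \<in> \<Inter>?T" if "direct_summand K x s \<and> s \<in> \<Inter>?T" for x s
    proof (rule InterI)
      fix A assume A: "A \<in> ?T"
      with that have "s \<in> A" by blast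
      with thick_summand[OF T[OF A]] that show "x \<in> A" by blast
    qed
  qed
  then show ?thesis by simp
qed

lemma thick_Int:
  assumes "triangulated_category K" "thick K A" "thick K B"
  shows "thick K (A \<inter> B)"
proof -
  have "Obj K \<inter> \<Inter>{A, B} = A \<inter> B"
    using thick_subset[OF assms(2)] by auto
  then show ?thesis
    using thick_Inter[OF assms(1), of "{A, B}"] assms(2,3) by auto
qed

lemma partial_order_thick_lattice: "partial_order (thick_lattice K)"
  by unfold_locales auto

lemma partial_order_open_lattice: "partial_order (open_lattice X)"
  by unfold_locales auto

lemma thick_Inf:
  assumes "triangulated_category K" "S \<subseteq> carrier (thick_lattice K)"
  shows "greatest (thick_lattice K) (Obj K \<inter> \<Inter>S) (Lower (thick_lattice K) S)"
proof (rule greatest_LowerI)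
  show "Obj K \<inter> \<Inter>S \<in> carrier (thick_lattice K)"
    using thick_Inter[OF assms(1), of S] assms(2) by auto
  show "B \<sqsubseteq>\<^bsub>thick_lattice K\<^esub> Obj K \<inter> \<Inter>S" if "B \<in> Lower (thick_lattice K) S" for B
    using that assms(2) thick_subset[of K B] by (auto simp: Lower_def)
qed (use assms(2) in auto)

lemma complete_lattice_thick_lattice:
  assumes "triangulated_category K"
  shows "complete_lattice (thick_lattice K)"
proof -
  interpret partial_order "thick_lattice K" by (rule partial_order_thick_lattice)
  show ?thesis
  proof (rule complete_lattice_criterion1)
    show "\<exists>g. greatest (thick_lattice K) g (carrier (thick_lattice K))"
      using thick_Inf[OF assms, of "{}"] by auto
    show "\<exists>i. greatest (thick_lattice K) i (Lower (thick_lattice K) S)"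
      if "S \<subseteq> carrier (thick_lattice K)" for S
      using thick_Inf[OF assms that] by blast
  qed
qed

lemma complete_lattice_open_lattice: "complete_lattice (open_lattice X)"
proof -
  interpret partial_order "open_lattice X" by (rule partial_order_open_lattice)
  show ?thesis
  proof (rule complete_latticeI)
    fix S assume S: "S \<subseteq> carrier (open_lattice X)"
    have "least (open_lattice X) (\<Union>S) (Upper (open_lattice X) S)"
      using S by (intro least_UpperI) (auto simp: Upper_def)
    then show "\<exists>s. least (open_lattice X) s (Upper (open_lattice X) S)" by blast
    have "greatest (open_lattice X) (\<Union>{U. openin X U \<and> (\<forall>V \<in> S. U \<subseteq> V)})
            (Lower (open_lattice X) S)"
      using S by (intro greatest_LowerI) (auto simp: Lower_def)
    then show "\<exists>i. greatest (open_lattice X) i (Lower (open_lattice X) S)" by blast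
  qed
qed

lemma thick_lattice_inf:
  assumes "triangulated_category K" "S \<subseteq> carrier (thick_lattice K)"
  shows "\<Sqinter>\<^bsub>thick_lattice K\<^esub> S = Obj K \<inter> \<Inter>S"
proof -
  interpret complete_lattice "thick_lattice K"
    by (rule complete_lattice_thick_lattice[OF assms(1)])
  show ?thesis
    using greatest_unique[OF inf_glb[OF assms(2)] thick_Inf[OF assms]] .
qed

lemma thick_lattice_meet:
  assumes "triangulated_category K" "thick K A" "thick K B"
  shows "A \<sqinter>\<^bsub>thick_lattice K\<^esub> B = A \<inter> B"
  using thick_lattice_inf[OF assms(1), of "{A, B}"] assms(2,3) thick_subset[OF assms(2)]
  by (auto simp: meet_def)

lemma thick_lattice_sup:
  assumes "triangulated_category K" "S \<subseteq> carrier (thick_lattice K)"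
  shows "\<Squnion>\<^bsub>thick_lattice K\<^esub> S = \<Inter>{B. thick K B \<and> \<Union>S \<subseteq> B}" (is "_ = ?J")
proof -
  interpret complete_lattice "thick_lattice K"
    by (rule complete_lattice_thick_lattice[OF assms(1)])
  have "Obj K \<in> {B. thick K B \<and> \<Union>S \<subseteq> B}"
    using thick_Obj[OF assms(1)] assms(2) thick_subset by fastforce
  then have "?J = Obj K \<inter> ?J" by blast
  then have "thick K ?J"
    using thick_Inter[OF assms(1), of "{B. thick K B \<and> \<Union>S \<subseteq> B}"] by simp
  then have "least (thick_lattice K) ?J (Upper (thick_lattice K) S)"
    using assms(2) by (intro least_UpperI) (auto simp: Upper_def)
  from least_unique[OF sup_lub[OF assms(2)] this] show ?thesis .
qed


section \<open>The non-tensor spectrum\<close>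

definition meet_prime :: "('o, 'm, 'x) tri_cat_struct_scheme \<Rightarrow> 'o set \<Rightarrow> bool" where
  "meet_prime K P \<longleftrightarrow> thick K P \<and> P \<noteq> Obj K \<and>
    (\<forall>A B. thick K A \<and> thick K B \<and> A \<inter> B \<subseteq> P \<longrightarrow> A \<subseteq> P \<or> B \<subseteq> P)"

lemma meet_prime_thick: "meet_prime K P \<Longrightarrow> thick K P"
  by (simp add: meet_prime_def)

definition spcnt_open :: "('o, 'm, 'x) tri_cat_struct_scheme \<Rightarrow> 'o set \<Rightarrow> 'o set set" where
  "spcnt_open K M = {P. meet_prime K P \<and> \<not> M \<subseteq> P}"

definition Spcnt :: "('o, 'm, 'x) tri_cat_struct_scheme \<Rightarrow> 'o set topology" where
  "Spcnt K = topology (\<lambda>U. \<exists>M. thick K M \<and> U = spcnt_open K M)"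

text \<open>
  The spectrum as the space of points of the lattice of thick subcategories: maps to the poset
  \<^typ>\<open>bool\<close> preserving finite meets and arbitrary joins. It is homeomorphic to
  \<^term>\<open>Spcnt K\<close> by \<open>homeomorphic_map_Spcnt\<close> below. Points are extensional functions on the
  carrier, so that equality of points is equality on thick subcategories.
\<close>

definition spcnt_points :: "('o, 'm, 'x) tri_cat_struct_scheme \<Rightarrow> ('o set \<Rightarrow> bool) set" where
  "spcnt_points K = (let L = thick_lattice K in {p \<in> carrier L \<rightarrow>\<^sub>E UNIV.
    mono_on (carrier L) p \<and>
    (\<forall>S \<subseteq> carrier L. finite S \<longrightarrow> p (\<Sqinter>\<^bsub>L\<^esub> S) = (\<forall>A \<in> S. p A)) \<and>
    (\<forall>S \<subseteq> carrier L. p (\<Squnion>\<^bsub>L\<^esub> S) = (\<exists>A \<in> S. p A))})"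

definition Spcnt_point_space ::
  "('o, 'm, 'x) tri_cat_struct_scheme \<Rightarrow> ('o set \<Rightarrow> bool) topology" where
  "Spcnt_point_space K =
    topology (\<lambda>U. \<exists>M. thick K M \<and> U = {p \<in> spcnt_points K. p M})"

definition prime_point :: "('o, 'm, 'x) tri_cat_struct_scheme \<Rightarrow> 'o set \<Rightarrow> 'o set \<Rightarrow> bool" where
  "prime_point K P = (\<lambda>M \<in> carrier (thick_lattice K). \<not> M \<subseteq> P)"

lemma prime_point_apply: "thick K M \<Longrightarrow> prime_point K P M = (\<not> M \<subseteq> P)"
  by (simp add: prime_point_def)

lemma prime_point_in_spcnt_points:
  assumes K: "triangulated_category K" and P: "meet_prime K P"
  shows "prime_point K P \<in> spcnt_points K"
proof -
  interpret complete_lattice "thick_lattice K"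
    by (rule complete_lattice_thick_lattice[OF K])
  have Inf: "(\<Sqinter>\<^bsub>thick_lattice K\<^esub> S \<subseteq> P) = (\<exists>A \<in> S. A \<subseteq> P)"
    if "finite S" "S \<subseteq> carrier (thick_lattice K)" for S
    using that
  proof (induction S)
    case empty
    then show ?case
      using P thick_lattice_inf[OF K, of "{}"] thick_subset[of K P] by (auto simp: meet_prime_def)
  next
    case (insert A S)
    have A: "thick K A" and S: "S \<subseteq> carrier (thick_lattice K)" using insert.prems by auto
    let ?I = "Obj K \<inter> \<Inter>S"
    have I: "thick K ?I" using thick_Inter[OF K, of S] S by auto
    have "\<Sqinter>\<^bsub>thick_lattice K\<^esub> (insert A S) = A \<inter> ?I"
      using thick_lattice_inf[OF K insert.prems] by auto
    then have "(\<Sqinter>\<^bsub>thick_lattice K\<^esub> (insert A S) \<subseteq> P) = (A \<subseteq> P \<or> ?I \<subseteq> P)"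
      using P A I unfolding meet_prime_def by (metis inf.coboundedI1 inf.coboundedI2)
    then show ?case
      using insert.IH[OF S] thick_lattice_inf[OF K S] by simp
  qed
  have Sup: "(\<Squnion>\<^bsub>thick_lattice K\<^esub> S \<subseteq> P) = (\<forall>A \<in> S. A \<subseteq> P)"
    if "S \<subseteq> carrier (thick_lattice K)" for S
  proof -
    have "thick K P" using P by (simp add: meet_prime_def)
    then show ?thesis
      unfolding thick_lattice_sup[OF K that] by blast
  qed
  show ?thesis
    unfolding spcnt_points_def Let_def mem_Collect_eq
  proof (intro conjI allI impI)
    show "prime_point K P \<in> carrier (thick_lattice K) \<rightarrow>\<^sub>E UNIV"
      by (auto simp: prime_point_def)
    show "mono_on (carrier (thick_lattice K)) (prime_point K P)"
      by (auto simp: prime_point_def mono_on_def)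
  next
    fix S assume S: "S \<subseteq> carrier (thick_lattice K)" "finite S"
    have "thick K (\<Sqinter>\<^bsub>thick_lattice K\<^esub> S)" using inf_closed[OF S(1)] by simp
    moreover have "prime_point K P A = (\<not> A \<subseteq> P)" if "A \<in> S" for A
      using that S by (intro prime_point_apply) auto
    ultimately show "prime_point K P (\<Sqinter>\<^bsub>thick_lattice K\<^esub> S) = (\<forall>A \<in> S. prime_point K P A)"
      using Inf[OF S(2,1)] prime_point_apply by metis
  next
    fix S assume S: "S \<subseteq> carrier (thick_lattice K)"
    have "thick K (\<Squnion>\<^bsub>thick_lattice K\<^esub> S)" using sup_closed[OF S] by simp
    moreover have "prime_point K P A = (\<not> A \<subseteq> P)" if "A \<in> S" for A
      using that S by (intro prime_point_apply) auto
    ultimately show "prime_point K P (\<Squnion>\<^bsub>thick_lattice K\<^esub> S) = (\<exists>A \<in> S. prime_point K P A)"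
      using Sup[OF S] prime_point_apply by metis
  qed
qed

lemma spcnt_pointsD:
  assumes K: "triangulated_category K" and p: "p \<in> spcnt_points K"
  shows spcnt_points_mono: "\<lbrakk>thick K A; thick K B; A \<subseteq> B; p A\<rbrakk> \<Longrightarrow> p B"
    and spcnt_points_Obj: "p (Obj K)"
    and spcnt_points_Int: "\<lbrakk>thick K A; thick K B\<rbrakk> \<Longrightarrow> p (A \<inter> B) = (p A \<and> p B)"
    and spcnt_points_Sup: "S \<subseteq> carrier (thick_lattice K) \<Longrightarrow>
      p (\<Squnion>\<^bsub>thick_lattice K\<^esub> S) = (\<exists>A \<in> S. p A)"
proof -
  have Inf: "p (\<Sqinter>\<^bsub>thick_lattice K\<^esub> S) = (\<forall>A \<in> S. p A)"
    if "S \<subseteq> carrier (thick_lattice K)" "finite S" for S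
    using p that unfolding spcnt_points_def Let_def by blast
  show "\<lbrakk>thick K A; thick K B; A \<subseteq> B; p A\<rbrakk> \<Longrightarrow> p B"
    using p by (auto simp: spcnt_points_def Let_def mono_on_def)
  show "p (Obj K)"
    using Inf[of "{}"] thick_lattice_inf[OF K, of "{}"] by simp
  show "\<lbrakk>thick K A; thick K B\<rbrakk> \<Longrightarrow> p (A \<inter> B) = (p A \<and> p B)"
    using Inf[of "{A, B}"] thick_lattice_meet[OF K, of A B] by (simp add: meet_def)
  show "S \<subseteq> carrier (thick_lattice K) \<Longrightarrow> p (\<Squnion>\<^bsub>thick_lattice K\<^esub> S) = (\<exists>A \<in> S. p A)"
    using p unfolding spcnt_points_def Let_def by blast
qed

lemma spcnt_points_eq:
  assumes K: "triangulated_category K"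
  shows "spcnt_points K = prime_point K ` {P. meet_prime K P}"
proof
  show "prime_point K ` {P. meet_prime K P} \<subseteq> spcnt_points K"
    using prime_point_in_spcnt_points[OF K] by blast
  show "spcnt_points K \<subseteq> prime_point K ` {P. meet_prime K P}"
  proof
    fix p assume p: "p \<in> spcnt_points K"
    interpret complete_lattice "thick_lattice K"
      by (rule complete_lattice_thick_lattice[OF K])
    let ?S = "{M. thick K M \<and> \<not> p M}"
    define P where "P = \<Squnion>\<^bsub>thick_lattice K\<^esub> ?S"
    have S: "?S \<subseteq> carrier (thick_lattice K)" by auto
    have P: "thick K P" using sup_closed[OF S] by (simp add: P_def)
    have "\<not> p P" unfolding P_def using spcnt_points_Sup[OF K p S] by blast
    then have iff: "p M = (\<not> M \<subseteq> P)" if "thick K M" for M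
      using that spcnt_points_mono[OF K p that P] sup_upper[OF S, of M] by (auto simp: P_def)
    have "meet_prime K P"
      unfolding meet_prime_def
    proof (intro conjI allI impI)
      show "P \<noteq> Obj K" using spcnt_points_Obj[OF K p] \<open>\<not> p P\<close> by auto
      fix A B assume AB: "thick K A \<and> thick K B \<and> A \<inter> B \<subseteq> P"
      then have "thick K (A \<inter> B)"
        using thick_Int[OF K] by blast
      then show "A \<subseteq> P \<or> B \<subseteq> P"
        using AB iff spcnt_points_Int[OF K p] by blast
    qed (rule P)
    moreover have "p = prime_point K P"
    proof
      fix M show "p M = prime_point K P M"
        using iff p by (cases "thick K M")
          (auto simp: prime_point_def spcnt_points_def Let_def PiE_def extensional_def)
    qed
    ultimately show "p \<in> prime_point K ` {P. meet_prime K P}" by blast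
  qed
qed

lemma inj_on_prime_point: "inj_on (prime_point K) {P. meet_prime K P}"
proof (rule inj_onI)
  fix P Q assume PQ: "P \<in> {P. meet_prime K P}" "Q \<in> {P. meet_prime K P}"
    and eq: "prime_point K P = prime_point K Q"
  have "M \<subseteq> P \<longleftrightarrow> M \<subseteq> Q" if "thick K M" for M
    using fun_cong[OF eq, of M] that by (simp add: prime_point_def)
  then show "P = Q" using PQ by (auto simp: meet_prime_def)
qed

lemma istopology_Spcnt:
  assumes K: "triangulated_category K"
  shows "istopology (\<lambda>U. \<exists>M. thick K M \<and> U = spcnt_open K M)"
  unfolding istopology_def
proof (intro conjI allI impI)
  fix U V
  assume "\<exists>M. thick K M \<and> U = spcnt_open K M" "\<exists>M. thick K M \<and> V = spcnt_open K M"
  then obtain M N where MN: "thick K M" "thick K N"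
    and UV: "U = spcnt_open K M" "V = spcnt_open K N" by blast
  have "thick K (M \<inter> N)"
    using thick_Int[OF K] MN by blast
  moreover have "U \<inter> V = spcnt_open K (M \<inter> N)"
    using MN by (auto simp: UV spcnt_open_def meet_prime_def)
  ultimately show "\<exists>M. thick K M \<and> U \<inter> V = spcnt_open K M" by blast
next
  fix \<U> assume "\<forall>U \<in> \<U>. \<exists>M. thick K M \<and> U = spcnt_open K M"
  then obtain m where m: "\<And>U. U \<in> \<U> \<Longrightarrow> thick K (m U)"
    and m_open: "\<And>U. U \<in> \<U> \<Longrightarrow> spcnt_open K (m U) = U" by metis
  interpret complete_lattice "thick_lattice K"
    by (rule complete_lattice_thick_lattice[OF K])
  have S: "m ` \<U> \<subseteq> carrier (thick_lattice K)" using m by auto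
  let ?J = "\<Squnion>\<^bsub>thick_lattice K\<^esub> (m ` \<U>)"
  have J: "thick K ?J" using sup_closed[OF S] by simp
  have "?J \<subseteq> P \<longleftrightarrow> (\<forall>U \<in> \<U>. m U \<subseteq> P)" if "thick K P" for P
    unfolding thick_lattice_sup[OF K S] using that by blast
  then have "spcnt_open K ?J = (\<Union>U \<in> \<U>. spcnt_open K (m U))"
    unfolding spcnt_open_def using meet_prime_thick by fast
  also have "\<dots> = \<Union>\<U>" using m_open by simp
  finally have "\<Union>\<U> = spcnt_open K ?J" ..
  with J show "\<exists>M. thick K M \<and> \<Union>\<U> = spcnt_open K M" by blast
qed

lemma openin_Spcnt:
  assumes "triangulated_category K"
  shows "openin (Spcnt K) U \<longleftrightarrow> (\<exists>M. thick K M \<and> U = spcnt_open K M)"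
  by (simp add: Spcnt_def istopology_Spcnt[OF assms])

lemma topspace_Spcnt:
  assumes "triangulated_category K"
  shows "topspace (Spcnt K) = {P. meet_prime K P}"
proof -
  have "Obj K \<subseteq> P \<longleftrightarrow> P = Obj K" if "meet_prime K P" for P
    using thick_subset[OF meet_prime_thick[OF that]] by blast
  then have "spcnt_open K (Obj K) = {P. meet_prime K P}"
    unfolding spcnt_open_def by (auto simp: meet_prime_def)
  then have "openin (Spcnt K) {P. meet_prime K P}"
    unfolding openin_Spcnt[OF assms] using thick_Obj[OF assms] by metis
  moreover have "U \<subseteq> {P. meet_prime K P}" if "openin (Spcnt K) U" for U
    using that unfolding openin_Spcnt[OF assms] spcnt_open_def by (elim exE conjE) auto
  ultimately show ?thesis
    by (intro subset_antisym openin_subset) (simp_all add: topspace_def Sup_le_iff)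
qed

lemma prime_point_image:
  assumes "triangulated_category K" "thick K M"
  shows "{p \<in> spcnt_points K. p M} = prime_point K ` spcnt_open K M"
  unfolding spcnt_points_eq[OF assms(1)] spcnt_open_def
  by (auto simp: prime_point_apply[OF assms(2)])

lemma prime_point_opens:
  assumes K: "triangulated_category K"
  shows "(\<exists>M. thick K M \<and> U = {p \<in> spcnt_points K. p M}) \<longleftrightarrow>
    (\<exists>V. openin (Spcnt K) V \<and> U = prime_point K ` V)"
proof
  assume "\<exists>M. thick K M \<and> U = {p \<in> spcnt_points K. p M}"
  then obtain M where M: "thick K M" "U = {p \<in> spcnt_points K. p M}" by (elim exE conjE)
  have "openin (Spcnt K) (spcnt_open K M)"
    unfolding openin_Spcnt[OF K] using M(1) by (intro exI[of _ M]) simp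
  moreover have "U = prime_point K ` spcnt_open K M"
    using M(2) prime_point_image[OF K M(1)] by simp
  ultimately show "\<exists>V. openin (Spcnt K) V \<and> U = prime_point K ` V" by blast
next
  assume "\<exists>V. openin (Spcnt K) V \<and> U = prime_point K ` V"
  then obtain M where M: "thick K M" "U = prime_point K ` spcnt_open K M"
    unfolding openin_Spcnt[OF K] by (elim exE conjE) simp
  then have "U = {p \<in> spcnt_points K. p M}"
    using prime_point_image[OF K M(1)] by simp
  with M(1) show "\<exists>M. thick K M \<and> U = {p \<in> spcnt_points K. p M}" by blast
qed

lemma openin_Spcnt_point_space:
  assumes K: "triangulated_category K"
  shows "openin (Spcnt_point_space K) U \<longleftrightarrow> (\<exists>M. thick K M \<and> U = {p \<in> spcnt_points K. p M})"
proof -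
  let ?f = "prime_point K"
  have eq: "(\<exists>M. thick K M \<and> U = {p \<in> spcnt_points K. p M}) \<longleftrightarrow>
      (\<exists>V. openin (Spcnt K) V \<and> U = ?f ` V)" for U
    by (rule prime_point_opens[OF K])
  have inj: "inj_on ?f (topspace (Spcnt K))"
    unfolding topspace_Spcnt[OF K] by (rule inj_on_prime_point)
  have "istopology (\<lambda>U. \<exists>V. openin (Spcnt K) V \<and> U = ?f ` V)"
    unfolding istopology_def
  proof (intro conjI allI impI)
    fix S T assume "\<exists>V. openin (Spcnt K) V \<and> S = ?f ` V" "\<exists>V. openin (Spcnt K) V \<and> T = ?f ` V"
    then obtain V W where "openin (Spcnt K) V" "openin (Spcnt K) W" "S = ?f ` V" "T = ?f ` W"
      by blast
    then show "\<exists>V. openin (Spcnt K) V \<and> S \<inter> T = ?f ` V"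
      using inj_on_image_Int[OF inj openin_subset openin_subset, of V W]
      by (intro exI[of _ "V \<inter> W"]) auto
  next
    fix \<U> assume "\<forall>U \<in> \<U>. \<exists>V. openin (Spcnt K) V \<and> U = ?f ` V"
    then obtain v where v: "\<And>U. U \<in> \<U> \<Longrightarrow> openin (Spcnt K) (v U)"
      and v_image: "\<And>U. U \<in> \<U> \<Longrightarrow> ?f ` v U = U" by metis
    have "openin (Spcnt K) (\<Union>(v ` \<U>))" using v by blast
    moreover have "\<Union>\<U> = ?f ` \<Union>(v ` \<U>)" unfolding image_UN using v_image by simp
    ultimately show "\<exists>V. openin (Spcnt K) V \<and> \<Union>\<U> = ?f ` V" by blast
  qed
  then show ?thesis
    unfolding Spcnt_point_space_def eq by simp
qed

lemma homeomorphic_map_Spcnt: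
  assumes K: "triangulated_category K"
  shows "homeomorphic_map (Spcnt K) (Spcnt_point_space K) (prime_point K)"
proof -
  have inj: "inj_on (prime_point K) (topspace (Spcnt K))"
    unfolding topspace_Spcnt[OF K] by (rule inj_on_prime_point)
  have op: "openin (Spcnt_point_space K) U \<longleftrightarrow>
      (\<exists>V. openin (Spcnt K) V \<and> U = prime_point K ` V)" for U
    unfolding openin_Spcnt_point_space[OF K] by (rule prime_point_opens[OF K])
  have top: "topspace (Spcnt_point_space K) = prime_point K ` topspace (Spcnt K)"
  proof
    obtain V where "openin (Spcnt K) V" "topspace (Spcnt_point_space K) = prime_point K ` V"
      using op[of "topspace (Spcnt_point_space K)"] by auto
    then show "topspace (Spcnt_point_space K) \<subseteq> prime_point K ` topspace (Spcnt K)"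
      using image_mono[OF openin_subset] by simp
    show "prime_point K ` topspace (Spcnt K) \<subseteq> topspace (Spcnt_point_space K)"
      using op[of "prime_point K ` topspace (Spcnt K)"] by (intro openin_subset) auto
  qed
  have "open_map (Spcnt K) (Spcnt_point_space K) (prime_point K)"
    unfolding open_map_def using op by blast
  moreover have "continuous_map (Spcnt K) (Spcnt_point_space K) (prime_point K)"
    unfolding continuous_map_def
  proof (intro conjI allI impI)
    show "prime_point K \<in> topspace (Spcnt K) \<rightarrow> topspace (Spcnt_point_space K)"
      using top by simp
    fix U assume "openin (Spcnt_point_space K) U"
    then obtain V where V: "openin (Spcnt K) V" "U = prime_point K ` V" using op by auto
    have "{x \<in> topspace (Spcnt K). prime_point K x \<in> U} = V"
      unfolding V(2) using inj_on_image_mem_iff[OF inj _ openin_subset[OF V(1)]]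
        openin_subset[OF V(1)] by auto
    with V(1) show "openin (Spcnt K) {x \<in> topspace (Spcnt K). prime_point K x \<in> U}" by simp
  qed
  ultimately show ?thesis
    using top inj by (intro bijective_open_imp_homeomorphic_map) simp_all
qed

end

theory Submission
  imports Defs
begin

text \<open>
  This is a Stone-type representation theorem, and everything reduces to a separation property:
  for thick \<open>M\<close> and an object \<open>x \<notin> M\<close> there is a meet-prime \<open>P \<supseteq> M\<close> with
  \<open>x \<notin> P\<close> (\<open>meet_prime_separation\<close>). It says that \<open>M\<close> is the intersection of the primes
  above it. These primes are exactly the points outside \<open>U\<^sub>M\<close>, so \<open>M\<close> can be recovered from
  \<open>U\<^sub>M\<close> by the stated formula. Surjectivity is the definition of the topology, and
  compatibility with meets is primality, and compatibility with joins is the universal property of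
  the join.

  The separation property uses two features of the lattice. The closure conditions defining thick
  subcategories are finitary, so directed unions of thick subcategories are thick
  (\<open>thick_directed_Union\<close>), and Zorn's lemma gives a thick \<open>P \<supseteq> M\<close> maximal among those not
  containing \<open>x\<close>. Distributivity then forces such a \<open>P\<close> to be prime: if \<open>A\<close> and \<open>B\<close> are not
  contained in \<open>P\<close>, then by maximality \<open>x\<close> lies in both \<open>P \<or> A\<close> and \<open>P \<or> B\<close>,
  hence in \<open>P \<or> (A \<inter> B)\<close>, which therefore differs from \<open>P\<close>.
\<close>

text \<open>
  Each closure condition has at most two premises of the form \<open>x \<in> A\<close>, so any instance of it
  over the union already takes place inside one member of the family.
\<close>

lemma thick_directed_Union:
  assumes "\<C> \<noteq> {}" and thick: "\<And>A. A \<in> \<C> \<Longrightarrow> thick K A"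
    and directed: "\<And>A B. \<lbrakk>A \<in> \<C>; B \<in> \<C>\<rbrakk> \<Longrightarrow> \<exists>C \<in> \<C>. A \<subseteq> C \<and> B \<subseteq> C"
  shows "thick K (\<Union>\<C>)"
  unfolding thick_def
proof (intro conjI allI impI ballI)
  show "\<Union>\<C> \<subseteq> Obj K"
    using thick_subset[OF thick] by blast
  show "\<Union>\<C> \<noteq> {}"
    using assms(1) thick_nonempty[OF thick] by blast
  show "y \<in> \<Union>\<C>" if x: "x \<in> \<Union>\<C> \<and> isomorphic K x y" for x y
  proof -
    obtain A where "A \<in> \<C>" "x \<in> A" using x by blast
    then show ?thesis
      using thick_iso[OF thick] x by blast
  qed
  show "x \<in> \<Union>\<C> \<longleftrightarrow> Susp K x \<in> \<Union>\<C>" if "x \<in> Obj K" for x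
    using thick_Susp[OF thick that] by blast
  show "z \<in> \<Union>\<C>" if xyz: "dist_triangle K x y z f g h \<and> x \<in> \<Union>\<C> \<and> y \<in> \<Union>\<C>" for x y z f g h
  proof -
    obtain A B where "A \<in> \<C>" "B \<in> \<C>" "x \<in> A" "y \<in> B" using xyz by blast
    with directed obtain C where "C \<in> \<C>" "x \<in> C" "y \<in> C" by blast
    then show ?thesis
      using thick_cone[OF thick[OF \<open>C \<in> \<C>\<close>]] xyz by blast
  qed
  show "x \<in> \<Union>\<C>" if xs: "direct_summand K x s \<and> s \<in> \<Union>\<C>" for x s
  proof -
    obtain A where "A \<in> \<C>" "s \<in> A" using xs by blast
    then show ?thesis
      using thick_summand[OF thick] xs by blast
  qed
qed

lemma thick_lattice_join:
  assumes K: "triangulated_category K" and A: "thick K A" and B: "thick K B"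
  shows thick_join: "thick K (A \<squnion>\<^bsub>thick_lattice K\<^esub> B)"
    and thick_join_upper1: "A \<subseteq> A \<squnion>\<^bsub>thick_lattice K\<^esub> B"
    and thick_join_upper2: "B \<subseteq> A \<squnion>\<^bsub>thick_lattice K\<^esub> B"
    and thick_join_least:
      "\<lbrakk>thick K C; A \<subseteq> C; B \<subseteq> C\<rbrakk> \<Longrightarrow> A \<squnion>\<^bsub>thick_lattice K\<^esub> B \<subseteq> C"
proof -
  interpret complete_lattice "thick_lattice K"
    by (rule complete_lattice_thick_lattice[OF K])
  show "thick K (A \<squnion>\<^bsub>thick_lattice K\<^esub> B)"
    using join_closed[of A B] A B by simp
  show "A \<subseteq> A \<squnion>\<^bsub>thick_lattice K\<^esub> B" "B \<subseteq> A \<squnion>\<^bsub>thick_lattice K\<^esub> B"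
    using join_left[of A B] join_right[of A B] A B by simp_all
  show "A \<squnion>\<^bsub>thick_lattice K\<^esub> B \<subseteq> C" if "thick K C" "A \<subseteq> C" "B \<subseteq> C"
    using join_le[of A C B] A B that by simp
qed

text \<open>
  This is the instance of the dual distributive law that primality needs; the hypothesis provides
  only the law for meets over joins. Distributing the meet with \<open>P \<or> B\<close> over \<open>P \<or> A\<close>, and then the meet with \<open>A\<close> over
  \<open>P \<or> B\<close>, expresses the intersection as a join of three thick subcategories of \<open>P\<close>.
\<close>

lemma distributive_Int_joins_subset:
  assumes K: "triangulated_category K" and dist: "distributive (thick_lattice K)"
    and thick: "thick K P" "thick K A" "thick K B" and AB: "A \<inter> B \<subseteq> P"
  shows "(P \<squnion>\<^bsub>thick_lattice K\<^esub> A) \<inter> (P \<squnion>\<^bsub>thick_lattice K\<^esub> B) \<subseteq> P"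
proof -
  let ?L = "thick_lattice K"
  have distrib: "C \<inter> (D \<squnion>\<^bsub>?L\<^esub> E) = (C \<inter> D) \<squnion>\<^bsub>?L\<^esub> (C \<inter> E)"
    if "thick K C" "thick K D" "thick K E" for C D E
  proof -
    have "C \<sqinter>\<^bsub>?L\<^esub> (D \<squnion>\<^bsub>?L\<^esub> E) = (C \<sqinter>\<^bsub>?L\<^esub> D) \<squnion>\<^bsub>?L\<^esub> (C \<sqinter>\<^bsub>?L\<^esub> E)"
      using dist that by (simp add: distributive_def)
    then show ?thesis
      using that thick_join[OF K that(2,3)] by (simp add: thick_lattice_meet[OF K])
  qed
  have "A \<inter> (P \<squnion>\<^bsub>?L\<^esub> B) = (A \<inter> P) \<squnion>\<^bsub>?L\<^esub> (A \<inter> B)"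
    using thick by (intro distrib)
  also have "\<dots> \<subseteq> P"
    using thick AB thick_Int[OF K] by (intro thick_join_least[OF K]) auto
  finally have meet_A: "(P \<squnion>\<^bsub>?L\<^esub> B) \<inter> A \<subseteq> P" by blast
  have PB: "thick K (P \<squnion>\<^bsub>?L\<^esub> B)"
    using thick_join[OF K] thick by blast
  have "(P \<squnion>\<^bsub>?L\<^esub> B) \<inter> (P \<squnion>\<^bsub>?L\<^esub> A) =
      ((P \<squnion>\<^bsub>?L\<^esub> B) \<inter> P) \<squnion>\<^bsub>?L\<^esub> ((P \<squnion>\<^bsub>?L\<^esub> B) \<inter> A)"
    using PB thick by (intro distrib)
  also have "\<dots> \<subseteq> P"
    using thick PB meet_A thick_Int[OF K] by (intro thick_join_least[OF K]) auto
  finally show ?thesis by blast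
qed

lemma exists_maximal_thick_avoiding:
  assumes "thick K M" "x \<notin> M"
  obtains P where "thick K P" "M \<subseteq> P" "x \<notin> P"
    and "\<And>Q. \<lbrakk>thick K Q; P \<subseteq> Q; x \<notin> Q\<rbrakk> \<Longrightarrow> Q = P"
proof -
  let ?S = "{Q. thick K Q \<and> M \<subseteq> Q \<and> x \<notin> Q}"
  have "\<exists>P \<in> ?S. \<forall>Q \<in> ?S. P \<subseteq> Q \<longrightarrow> Q = P"
  proof (rule subset_Zorn_nonempty)
    show "?S \<noteq> {}" using assms by blast
    fix \<C> assume ne: "\<C> \<noteq> {}" and "subset.chain ?S \<C>"
    then have \<C>: "\<C> \<subseteq> ?S" and chain: "\<And>A B. \<lbrakk>A \<in> \<C>; B \<in> \<C>\<rbrakk> \<Longrightarrow> A \<subseteq> B \<or> B \<subseteq> A"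
      unfolding subset_chain_def by blast+
    have "thick K (\<Union>\<C>)"
      using ne
    proof (rule thick_directed_Union)
      show "thick K A" if "A \<in> \<C>" for A
        using that \<C> by blast
      show "\<exists>C \<in> \<C>. A \<subseteq> C \<and> B \<subseteq> C" if "A \<in> \<C>" "B \<in> \<C>" for A B
        using chain[OF that] that by blast
    qed
    then show "\<Union>\<C> \<in> ?S" using ne \<C> by blast
  qed
  then obtain P where P: "P \<in> ?S" and max: "\<forall>Q \<in> ?S. P \<subseteq> Q \<longrightarrow> Q = P" ..
  show thesis
  proof (rule that)
    show "thick K P" "M \<subseteq> P" "x \<notin> P" using P by simp_all
    show "Q = P" if "thick K Q" "P \<subseteq> Q" "x \<notin> Q" for Q
      using max that P by blast
  qed
qed

text \<open>
  The analogue of the prime ideal theorem for distributive lattices: a thick subcategory that is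
  maximal among those avoiding a given object is meet-prime.
\<close>

lemma meet_prime_separation:
  assumes K: "triangulated_category K" and dist: "distributive (thick_lattice K)"
    and M: "thick K M" and x: "x \<in> Obj K" "x \<notin> M"
  obtains P where "meet_prime K P" "M \<subseteq> P" "x \<notin> P"
proof -
  let ?L = "thick_lattice K"
  obtain P where P: "thick K P" "M \<subseteq> P" "x \<notin> P"
    and max: "\<And>Q. \<lbrakk>thick K Q; P \<subseteq> Q; x \<notin> Q\<rbrakk> \<Longrightarrow> Q = P"
    by (rule exists_maximal_thick_avoiding[OF M x(2)]) blast
  have x_join: "x \<in> P \<squnion>\<^bsub>?L\<^esub> A" if "thick K A" "\<not> A \<subseteq> P" for A
    using max[OF thick_join[OF K P(1) that(1)] thick_join_upper1[OF K P(1) that(1)]]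
      thick_join_upper2[OF K P(1) that(1)] that(2) by blast
  have "A \<subseteq> P \<or> B \<subseteq> P" if "thick K A" "thick K B" "A \<inter> B \<subseteq> P" for A B
    using x_join that(1,2) P(3) distributive_Int_joins_subset[OF K dist P(1) that] by blast
  then have "meet_prime K P"
    using P x(1) unfolding meet_prime_def by blast
  then show thesis using P(2,3) by (rule that)
qed

lemma thick_eq_Inter_meet_primes:
  assumes "triangulated_category K" "distributive (thick_lattice K)" "thick K M"
  shows "Obj K \<inter> \<Inter>{P. meet_prime K P \<and> M \<subseteq> P} = M"
proof
  show "Obj K \<inter> \<Inter>{P. meet_prime K P \<and> M \<subseteq> P} \<subseteq> M"
  proof
    fix x assume x: "x \<in> Obj K \<inter> \<Inter>{P. meet_prime K P \<and> M \<subseteq> P}"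
    show "x \<in> M"
    proof (rule ccontr)
      assume "x \<notin> M"
      from x have "x \<in> Obj K" ..
      obtain P where "meet_prime K P" "M \<subseteq> P" "x \<notin> P"
        by (rule meet_prime_separation[OF assms \<open>x \<in> Obj K\<close> \<open>x \<notin> M\<close>])
      with x show False by blast
    qed
  qed
  show "M \<subseteq> Obj K \<inter> \<Inter>{P. meet_prime K P \<and> M \<subseteq> P}"
    using thick_subset[OF assms(3)] by blast
qed

lemma spcnt_open_Int:
  assumes "thick K A" "thick K B"
  shows "spcnt_open K (A \<inter> B) = spcnt_open K A \<inter> spcnt_open K B"
proof -
  have "A \<inter> B \<subseteq> P \<longleftrightarrow> A \<subseteq> P \<or> B \<subseteq> P" if "meet_prime K P" for P
    using assms that by (auto simp: meet_prime_def)
  then show ?thesis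
    by (auto simp: spcnt_open_def)
qed

lemma spcnt_open_join:
  assumes "triangulated_category K" "thick K A" "thick K B"
  shows "spcnt_open K (A \<squnion>\<^bsub>thick_lattice K\<^esub> B) = spcnt_open K A \<union> spcnt_open K B"
proof -
  have "A \<squnion>\<^bsub>thick_lattice K\<^esub> B \<subseteq> P \<longleftrightarrow> A \<subseteq> P \<and> B \<subseteq> P" if "meet_prime K P" for P
    using thick_join_upper1[OF assms] thick_join_upper2[OF assms]
      thick_join_least[OF assms meet_prime_thick[OF that]] by blast
  then show ?thesis
    by (auto simp: spcnt_open_def)
qed

lemma open_lattice_meet:
  assumes "openin X U" "openin X V"
  shows "U \<sqinter>\<^bsub>open_lattice X\<^esub> V = U \<inter> V"
proof -
  interpret complete_lattice "open_lattice X"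
    by (rule complete_lattice_open_lattice)
  have "U \<sqinter>\<^bsub>open_lattice X\<^esub> V \<subseteq> U \<inter> V"
    using meet_left[of U V] meet_right[of U V] assms by simp
  moreover have "U \<inter> V \<subseteq> U \<sqinter>\<^bsub>open_lattice X\<^esub> V"
    using meet_le[of "U \<inter> V" U V] assms openin_Int[OF assms] by simp
  ultimately show ?thesis ..
qed

lemma open_lattice_join:
  assumes "openin X U" "openin X V"
  shows "U \<squnion>\<^bsub>open_lattice X\<^esub> V = U \<union> V"
proof -
  interpret complete_lattice "open_lattice X"
    by (rule complete_lattice_open_lattice)
  have "U \<squnion>\<^bsub>open_lattice X\<^esub> V \<subseteq> U \<union> V"
    using join_le[of U "U \<union> V" V] assms openin_Un[OF assms] by simp
  moreover have "U \<union> V \<subseteq> U \<squnion>\<^bsub>open_lattice X\<^esub> V"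
    using join_left[of U V] join_right[of U V] assms by simp
  ultimately show ?thesis ..
qed

theorem theorem6p1p13:
  fixes K :: "('o, 'm, 'x) tri_cat_struct_scheme"
  assumes "triangulated_category K"
    and "distributive (thick_lattice K)"
  shows "lattice_iso (thick_lattice K) (open_lattice (Spcnt K)) (spcnt_open K) \<and>
    (\<forall>U. openin (Spcnt K) U \<longrightarrow>
      the_inv_into (carrier (thick_lattice K)) (spcnt_open K) U =
        Obj K \<inter> \<Inter>(topspace (Spcnt K) - U))"
proof -
  let ?L = "thick_lattice K" and ?X = "Spcnt K" and ?U = "spcnt_open K"
  have recover: "Obj K \<inter> \<Inter>(topspace ?X - ?U M) = M" if "thick K M" for M
  proof -
    have "topspace ?X - ?U M = {P. meet_prime K P \<and> M \<subseteq> P}"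
      unfolding topspace_Spcnt[OF assms(1)] spcnt_open_def by blast
    then show ?thesis
      using thick_eq_Inter_meet_primes[OF assms that] by simp
  qed
  have inj: "inj_on ?U (carrier ?L)"
    by (rule inj_on_inverseI[where g = "\<lambda>U. Obj K \<inter> \<Inter>(topspace ?X - U)"]) (simp add: recover)
  have "?U ` carrier ?L = carrier (open_lattice ?X)"
    using openin_Spcnt[OF assms(1)] by auto
  with inj have bij: "bij_betw ?U (carrier ?L) (carrier (open_lattice ?X))"
    by (simp add: bij_betw_def)
  have op: "openin ?X (?U M)" if "thick K M" for M
    using that openin_Spcnt[OF assms(1)] by blast
  have hom: "?U (A \<sqinter>\<^bsub>?L\<^esub> B) = ?U A \<sqinter>\<^bsub>open_lattice ?X\<^esub> ?U B"
    "?U (A \<squnion>\<^bsub>?L\<^esub> B) = ?U A \<squnion>\<^bsub>open_lattice ?X\<^esub> ?U B"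
    if "thick K A" "thick K B" for A B
    using that by (simp_all add: op open_lattice_meet open_lattice_join spcnt_open_Int
        thick_lattice_meet[OF assms(1)] spcnt_open_join[OF assms(1)])
  have "the_inv_into (carrier ?L) ?U U = Obj K \<inter> \<Inter>(topspace ?X - U)" if "openin ?X U" for U
  proof -
    obtain M where "thick K M" "U = ?U M"
      using \<open>openin ?X U\<close> openin_Spcnt[OF assms(1)] by blast
    then show ?thesis
      using the_inv_into_f_f[OF inj, of M] recover by simp
  qed
  with bij hom show ?thesis
    by (simp add: lattice_iso_def)
qed

end
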